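(* Let $X$, $\mu$ and $\varphi:X\to X$ be the one-circuit directed graph with branching vertices $x_1,\dots,x_\kappa$, the measure and the parent map described in the context, and suppose that the composition operator $C_\varphi f=f\circ\varphi$ is bounded on $L^2(\mu)$. Then $C_\varphi$ is analytic if and only if for every $r\in J_{[1,\kappa]}$ the series $$\sum_{j=1}^{\infty}\ \sum_{\substack{s=1\\ r=\Phi_2(s+j)}}^{\kappa}\ \sum_{i=1}^{\eta_s}\mu(x^s_{i,j})$$ is divergent.
   Context: Notation: $\mathbb N=\{1,2,\dots\}$, $\mathbb Z_+=\{0,1,2,\dots\}$. $J_{[a,b]}$ denotes the set of integers $i$ with $a\le i\le b$ (so $J_{[1,0]}=\emptyset$ and $J_{[1,\infty]}=\mathbb N$). Setting: let $\kappa\in\mathbb N$ and $\eta_1,\dots,\eta_\kappa\in\mathbb Z_+\cup\{\infty\}$, at least one $\eta_r$ nonzero. Let $X=\{x_1,\dots,x_\kappa\}\cup\bigcup_{r=1}^{\kappa}\{x^r_{i,j}: i\in J_{[1,\eta_r]},\ j\in\mathbb N\}$ (all listed points distinct), with the $\sigma$-algebra of all subsets and a measure $\mu$ with $0<\mu(x):=\mu(\{x\})<\infty$ for every $x\in X$. $\Phi_2:\mathbb Z\to J_{[1,\kappa]}$ is the function for which there is a (unique) $\Phi_1:\mathbb Z\to\mathbb Z$ with $p=\Phi_1(p)\kappa+\Phi_2(p)$ for all $p\in\mathbb Z$ (i.e. $\Phi_2(p)$ is the residue of $p$ modulo $\kappa$ in $\{1,\dots,\kappa\}$). The map $\varphi:X\to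 X$ is the parent map: $\varphi(x^r_{i,j+1})=x^r_{i,j}$ and $\varphi(x^r_{i,1})=x_r$ for $r\in J_{[1,\kappa]}$, $i\in J_{[1,\eta_r]}$, $j\in\mathbb N$, and $\varphi(x_{\Phi_2(1+r)})=x_r$ for $r\in J_{[1,\kappa]}$. Functions in $L^2(\mu)$ are complex valued. Definition: a bounded operator $T$ on a Hilbert space $\mathcal H$ is analytic if $\mathcal R^\infty(T):=\bigcap_{n=0}^\infty T^n(\mathcal H)=\{0\}$. *)

theory Defs
  imports "HOL-Analysis.Analysis" "HOL-Library.Extended_Nat"
begin

definition J :: "enat \<Rightarrow> nat set" where
  "J e = {i. 1 \<le> i \<and> enat i \<le> e}"

definition Phi2 :: "nat \<Rightarrow> int \<Rightarrow> nat" where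
  "Phi2 \<kappa> p = (THE r. r \<in> {1..\<kappa>} \<and> (\<exists>q::int. p = q * int \<kappa> + int r))"

lemma Phi2_unique:
  assumes "1 \<le> \<kappa>"
  shows "\<exists>!r. r \<in> {1..\<kappa>} \<and> (\<exists>q::int. p = q * int \<kappa> + int r)"
proof (rule ex1I)
  have k: "int \<kappa> > 0" using assms by simp
  let ?r = "nat ((p - 1) mod int \<kappa> + 1)"
  have b: "0 \<le> (p - 1) mod int \<kappa>" "(p - 1) mod int \<kappa> < int \<kappa>" using k by simp_all
  have "p = ((p - 1) div int \<kappa>) * int \<kappa> + int ?r"
    using b(1) div_mult_mod_eq[of "p - 1" "int \<kappa>"] by simp
  then have "\<exists>q::int. p = q * int \<kappa> + int ?r" by (rule exI)
  moreover have "?r \<in> {1..\<kappa>}" using b by auto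
  ultimately show "?r \<in> {1..\<kappa>} \<and> (\<exists>q::int. p = q * int \<kappa> + int ?r)" by blast
next
  fix r assume r: "r \<in> {1..\<kappa>} \<and> (\<exists>q::int. p = q * int \<kappa> + int r)"
  then obtain q :: int where q: "p = q * int \<kappa> + int r" by blast
  have "(p - 1) mod int \<kappa> = (int r - 1 + q * int \<kappa>) mod int \<kappa>" using q by (simp add: algebra_simps)
  also have "\<dots> = (int r - 1) mod int \<kappa>" by simp
  also have "\<dots> = int r - 1" using r by (intro mod_pos_pos_trivial) auto
  finally show "r = nat ((p - 1) mod int \<kappa> + 1)" by simp
qed

text \<open>The vertex x r i j below is the point written x with superscript r and subscript (i, j);
  x0 r is the branching vertex with index r. The values of x0, x and \<phi> outside the index
  ranges, respectively outside the vertex set, are irrelevant.\<close>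

locale one_circuit_graph =
  fixes \<kappa> :: nat
    and \<eta> :: "nat \<Rightarrow> enat"
    and x0 :: "nat \<Rightarrow> 'a"
    and x :: "nat \<Rightarrow> nat \<Rightarrow> nat \<Rightarrow> 'a"
    and M :: "'a measure"
    and \<phi> :: "'a \<Rightarrow> 'a"
  assumes kappa_pos: "1 \<le> \<kappa>"
    and eta_nonzero: "\<exists>r\<in>{1..\<kappa>}. \<eta> r \<noteq> 0"
    and inj_x0: "inj_on x0 {1..\<kappa>}"
    and inj_x: "inj_on (\<lambda>(r, i, j). x r i j) {(r, i, j). r \<in> {1..\<kappa>} \<and> i \<in> J (\<eta> r) \<and> 1 \<le> j}"
    and disjoint: "\<And>s r i j. s \<in> {1..\<kappa>} \<Longrightarrow> r \<in> {1..\<kappa>} \<Longrightarrow> i \<in> J (\<eta> r) \<Longrightarrow> 1 \<le> j \<Longrightarrow> x0 s \<noteq> x r i j"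
    and space_M: "space M = x0 ` {1..\<kappa>} \<union> (\<Union>r\<in>{1..\<kappa>}. {x r i j |i j. i \<in> J (\<eta> r) \<and> 1 \<le> j})"
    and sets_M: "sets M = Pow (space M)"
    and mass: "\<And>v. v \<in> space M \<Longrightarrow> 0 < emeasure M {v} \<and> emeasure M {v} < \<infinity>"
    and phi_Suc: "\<And>r i j. r \<in> {1..\<kappa>} \<Longrightarrow> i \<in> J (\<eta> r) \<Longrightarrow> 1 \<le> j \<Longrightarrow> \<phi> (x r i (j + 1)) = x r i j"
    and phi_1: "\<And>r i. r \<in> {1..\<kappa>} \<Longrightarrow> i \<in> J (\<eta> r) \<Longrightarrow> \<phi> (x r i 1) = x0 r"
    and phi_circuit: "\<And>r. r \<in> {1..\<kappa>} \<Longrightarrow> \<phi> (x0 (Phi2 \<kappa> (1 + int r))) = x0 r"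

text \<open>Elements of the space are represented by functions that vanish off the space of M. No quotient
  by almost-everywhere equality is taken: in the setting above every point has positive mass,
  so each class has exactly one representative (lemma L2_AE_eq_iff).\<close>

definition L2 :: "'a measure \<Rightarrow> ('a \<Rightarrow> complex) set" where
  "L2 M = {f. f \<in> borel_measurable M \<and> integrable M (\<lambda>v. (cmod (f v))\<^sup>2) \<and>
              (\<forall>v. v \<notin> space M \<longrightarrow> f v = 0)}"

definition L2_norm :: "'a measure \<Rightarrow> ('a \<Rightarrow> complex) \<Rightarrow> real" where
  "L2_norm M f = sqrt (integral\<^sup>L M (\<lambda>v. (cmod (f v))\<^sup>2))"

lemma (in one_circuit_graph) L2_AE_eq_iff:
  assumes "f \<in> L2 M" "g \<in> L2 M"
  shows "(AE v in M. f v = g v) \<longleftrightarrow> f = g"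
proof
  assume "AE v in M. f v = g v"
  then obtain N where N: "{v \<in> space M. f v \<noteq> g v} \<subseteq> N" "emeasure M N = 0" "N \<in> sets M"
    by (auto elim: AE_E)
  have "f v = g v" for v
  proof (cases "v \<in> space M")
    case True
    show ?thesis
    proof (rule ccontr)
      assume "f v \<noteq> g v"
      with True N have "emeasure M {v} \<le> emeasure M N" by (intro emeasure_mono) auto
      with N(2) mass[OF True] show False by simp
    qed
  qed (use assms in \<open>simp add: L2_def\<close>)
  then show "f = g" by blast
qed simp

definition bounded_operator_L2 :: "'a measure \<Rightarrow> (('a \<Rightarrow> complex) \<Rightarrow> 'a \<Rightarrow> complex) \<Rightarrow> bool" where
  "bounded_operator_L2 M T \<longleftrightarrow>
     (\<forall>f\<in>L2 M. T f \<in> L2 M) \<and>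
     (\<forall>f\<in>L2 M. \<forall>g\<in>L2 M. T (\<lambda>v. f v + g v) = (\<lambda>v. T f v + T g v)) \<and>
     (\<forall>c. \<forall>f\<in>L2 M. T (\<lambda>v. c * f v) = (\<lambda>v. c * T f v)) \<and>
     (\<exists>K. \<forall>f\<in>L2 M. L2_norm M (T f) \<le> K * L2_norm M f)"

definition analytic_L2 :: "'a measure \<Rightarrow> (('a \<Rightarrow> complex) \<Rightarrow> 'a \<Rightarrow> complex) \<Rightarrow> bool" where
  "analytic_L2 M T \<longleftrightarrow> (\<Inter>n::nat. (T ^^ n) ` L2 M) = {\<lambda>v. 0}"

definition comp_op :: "'a measure \<Rightarrow> ('a \<Rightarrow> 'a) \<Rightarrow> ('a \<Rightarrow> complex) \<Rightarrow> 'a \<Rightarrow> complex" where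
  "comp_op M \<phi> f = (\<lambda>v. if v \<in> space M then f (\<phi> v) else 0)"

end

theory Submission
  imports Defs
begin

text \<open>
  Call two vertices equivalent if some power of \<open>\<phi>\<close> sends them to the same vertex. Going back
  \<open>j\<close> steps from \<open>x s i j\<close> leads to \<open>x0 s\<close>, and going back \<open>j\<close> steps from the circuit vertex
  whose index is \<open>s + j\<close> modulo \<open>\<kappa>\<close> leads to \<open>x0 s\<close> as well. So each equivalence class contains
  exactly one circuit vertex \<open>x0 r\<close>, and consists of it and of all \<open>x s i j\<close> with
  \<open>s + j \<equiv> r\<close> modulo \<open>\<kappa>\<close>. The series in the theorem is the measure of the class of \<open>x0 r\<close>
  without \<open>x0 r\<close> itself; as that point has finite mass, the series diverges if and only if the
  class has infinite measure (\<open>series_infinite_iff\<close>).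

  The powers of the composition operator are \<open>f \<mapsto> f \<circ> \<phi>\<^sup>n\<close>, so a function in the range of
  all of them takes equal values at equivalent vertices
  (\<open>range_infinity_constant_on_merging_class\<close>). If it is square integrable and
  every class has infinite measure, it must vanish, and the operator is analytic.

  Conversely, \<open>\<phi>\<close> permutes the \<open>\<kappa>\<close> classes cyclically (\<open>phi_in_merging_class_iff\<close>), so the
  operator maps the indicator of a class to the indicator of the next one. If one class has finite
  measure, its indicator lies in the space, hence by boundedness so do the indicators of all
  classes, and under every power of the operator each of them is the image of one of them. The
  indicator of the given class is then a nonzero element of the intersection of the ranges
  (\<open>indicator_in_range_infinity\<close>).
\<close>

section \<open>Unordered sums of measures\<close>

text \<open>Over the nonnegative extended reals every family is summable, so an unordered sum over a set
  of naturals is the ordinary series of the family extended by zero, and countable additivity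
  applies.\<close>

lemma infsum_emeasure_UN:
  fixes X :: "nat \<Rightarrow> 'a set"
  assumes "\<And>i. i \<in> I \<Longrightarrow> X i \<in> sets N" and "disjoint_family_on X I"
  shows "(\<Sum>\<^sub>\<infinity>i\<in>I. emeasure N (X i)) = emeasure N (\<Union>i\<in>I. X i)"
proof -
  define Y where "Y i = (if i \<in> I then X i else {})" for i
  have "((\<lambda>i. emeasure N (Y i)) has_sum (\<Sum>\<^sub>\<infinity>i\<in>UNIV. emeasure N (Y i))) UNIV"
    by (intro has_sum_infsum nonneg_summable_on_complete) simp
  then have "(\<Sum>\<^sub>\<infinity>i\<in>UNIV. emeasure N (Y i)) = (\<Sum>i. emeasure N (Y i))"
    using has_sum_imp_sums sums_unique by blast
  also have "\<dots> = emeasure N (\<Union>i. Y i)"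
    using assms by (intro suminf_emeasure) (auto simp: Y_def disjoint_family_on_def)
  also have "(\<Union>i. Y i) = (\<Union>i\<in>I. X i)"
    by (auto simp: Y_def split: if_splits)
  finally have "(\<Sum>\<^sub>\<infinity>i\<in>UNIV. emeasure N (Y i)) = emeasure N (\<Union>i\<in>I. X i)" .
  moreover have "(\<Sum>\<^sub>\<infinity>i\<in>UNIV. emeasure N (Y i)) = (\<Sum>\<^sub>\<infinity>i\<in>I. emeasure N (X i))"
    by (intro infsum_cong_neutral) (auto simp: Y_def)
  ultimately show ?thesis by simp
qed

section \<open>Residues modulo the length of the circuit\<close>

lemma Phi2_mem_and_dvd:
  assumes "1 \<le> \<kappa>"
  shows "Phi2 \<kappa> p \<in> {1..\<kappa>}" and "int \<kappa> dvd int (Phi2 \<kappa> p) - p"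
proof -
  have *: "Phi2 \<kappa> p \<in> {1..\<kappa>} \<and> (\<exists>q::int. p = q * int \<kappa> + int (Phi2 \<kappa> p))"
    unfolding Phi2_def by (rule theI'[OF Phi2_unique[OF assms]])
  then show "Phi2 \<kappa> p \<in> {1..\<kappa>}" by blast
  from * obtain q where "p = q * int \<kappa> + int (Phi2 \<kappa> p)" by blast
  then have "int (Phi2 \<kappa> p) - p = int \<kappa> * (- q)" by (simp add: algebra_simps)
  then show "int \<kappa> dvd int (Phi2 \<kappa> p) - p" by (rule dvdI)
qed

lemma Phi2_eq_iff:
  assumes "1 \<le> \<kappa>" and "r \<in> {1..\<kappa>}"
  shows "r = Phi2 \<kappa> p \<longleftrightarrow> int \<kappa> dvd int r - p"
proof
  assume "int \<kappa> dvd int r - p"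
  then obtain q where "int r - p = int \<kappa> * q" by (rule dvdE)
  then have "p = (- q) * int \<kappa> + int r" by (simp add: algebra_simps)
  with assms(2) show "r = Phi2 \<kappa> p"
    unfolding Phi2_def by (intro the1_equality[symmetric] Phi2_unique assms(1)) blast
qed (use Phi2_mem_and_dvd[OF assms(1)] in simp)

lemma dvd_diff_index_iff:
  assumes "1 \<le> \<kappa>" and "s \<in> {1..\<kappa>}" and "r \<in> {1..\<kappa>}"
  shows "int \<kappa> dvd int s - int r \<longleftrightarrow> s = r"
  using Phi2_eq_iff[OF assms(1,2), of "int r"] Phi2_eq_iff[OF assms(1,3), of "int r"] by auto

section \<open>Classes of vertices that merge under the parent map\<close>

context one_circuit_graph
begin

text \<open>The class is indexed by an integer that matters only modulo \<open>\<kappa>\<close>; then the action of the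
  parent map is a plain shift of the index, without reduction to \<open>{1..\<kappa>}\<close>.\<close>

definition merging_class :: "int \<Rightarrow> 'a set" where
  "merging_class p =
     {x0 s |s. s \<in> {1..\<kappa>} \<and> int \<kappa> dvd int s - p} \<union>
     {x s i j |s i j. s \<in> {1..\<kappa>} \<and> i \<in> J (\<eta> s) \<and> 1 \<le> j \<and> int \<kappa> dvd int s + int j - p}"

lemma vertex_cases:
  assumes "v \<in> space M"
  obtains (circuit) s where "s \<in> {1..\<kappa>}" "v = x0 s"
  | (branch) s i j where "s \<in> {1..\<kappa>}" "i \<in> J (\<eta> s)" "1 \<le> j" "v = x s i j"
  using assms unfolding space_M by blast

lemma circuit_vertex_in_space: "s \<in> {1..\<kappa>} \<Longrightarrow> x0 s \<in> space M"
  unfolding space_M by blast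

lemma branch_vertex_in_space:
  "s \<in> {1..\<kappa>} \<Longrightarrow> i \<in> J (\<eta> s) \<Longrightarrow> 1 \<le> j \<Longrightarrow> x s i j \<in> space M"
  unfolding space_M by blast

lemma branch_vertex_eq_iff:
  assumes "s \<in> {1..\<kappa>}" "i \<in> J (\<eta> s)" "1 \<le> j" "s' \<in> {1..\<kappa>}" "i' \<in> J (\<eta> s')" "1 \<le> j'"
  shows "x s i j = x s' i' j' \<longleftrightarrow> s = s' \<and> i = i' \<and> j = j'"
  using inj_onD[OF inj_x, of "(s, i, j)" "(s', i', j')"] assms by auto

lemma merging_class_subset_space: "merging_class p \<subseteq> space M"
  unfolding merging_class_def space_M by blast

lemma circuit_in_merging_class:
  assumes "s \<in> {1..\<kappa>}"
  shows "x0 s \<in> merging_class p \<longleftrightarrow> int \<kappa> dvd int s - p"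
proof
  assume "x0 s \<in> merging_class p"
  then obtain s' where "s' \<in> {1..\<kappa>}" "int \<kappa> dvd int s' - p" "x0 s = x0 s'"
    unfolding merging_class_def using disjoint[OF assms] by auto
  then show "int \<kappa> dvd int s - p" using inj_onD[OF inj_x0] assms by metis
qed (use assms in \<open>auto simp: merging_class_def\<close>)

lemma branch_in_merging_class:
  assumes "s \<in> {1..\<kappa>}" "i \<in> J (\<eta> s)" "1 \<le> j"
  shows "x s i j \<in> merging_class p \<longleftrightarrow> int \<kappa> dvd int s + int j - p"
proof
  assume "x s i j \<in> merging_class p"
  moreover have "x s i j \<noteq> x0 s'" if "s' \<in> {1..\<kappa>}" for s'
    using disjoint[OF that assms] by simp
  ultimately obtain s' i' j' where "s' \<in> {1..\<kappa>}" "i' \<in> J (\<eta> s')" "1 \<le> j'"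
      "int \<kappa> dvd int s' + int j' - p" "x s i j = x s' i' j'"
    unfolding merging_class_def by blast
  then show "int \<kappa> dvd int s + int j - p" using branch_vertex_eq_iff assms by metis
qed (use assms in \<open>auto simp: merging_class_def\<close>)

lemma merging_class_shift:
  assumes "int \<kappa> dvd p - q"
  shows "merging_class p = merging_class q"
proof -
  have "int \<kappa> dvd a - p \<longleftrightarrow> int \<kappa> dvd a - q" for a
    using dvd_add_right_iff[OF assms, of "a - p"] by simp
  then show ?thesis unfolding merging_class_def by presburger
qed

lemma vertex_in_some_merging_class:
  assumes "v \<in> space M"
  obtains r where "r \<in> {1..\<kappa>}" "v \<in> merging_class (int r)"
  using assms
proof (cases rule: vertex_cases)
  case (circuit s)
  then show thesis using that[of s] circuit_in_merging_class by simp
next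
  case (branch s i j)
  then show thesis
    using that[of "Phi2 \<kappa> (int s + int j)"] branch_in_merging_class
      Phi2_mem_and_dvd[OF kappa_pos, of "int s + int j"] by (simp add: dvd_diff_commute)
qed

lemma phi_circuit_pred:
  assumes "s \<in> {1..\<kappa>}"
  obtains t where "t \<in> {1..\<kappa>}" "\<phi> (x0 s) = x0 t" "int \<kappa> dvd int s - (int t + 1)"
proof -
  define t where "t = Phi2 \<kappa> (int s - 1)"
  have t: "t \<in> {1..\<kappa>}" "int \<kappa> dvd int t - (int s - 1)"
    unfolding t_def using Phi2_mem_and_dvd[OF kappa_pos] by auto
  then have d: "int \<kappa> dvd int s - (1 + int t)" by (subst dvd_diff_commute) (simp add: algebra_simps)
  then have "s = Phi2 \<kappa> (1 + int t)" using Phi2_eq_iff[OF kappa_pos assms] by simp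
  then show thesis using that[of t] phi_circuit[OF t(1)] t(1) d by (simp add: add.commute)
qed

lemma phi_in_space:
  assumes "v \<in> space M"
  shows "\<phi> v \<in> space M"
  using assms
proof (cases rule: vertex_cases)
  case (circuit s)
  then show ?thesis by (metis phi_circuit_pred circuit_vertex_in_space)
next
  case (branch s i j)
  show ?thesis
  proof (cases "j = 1")
    case True
    then show ?thesis using branch phi_1 circuit_vertex_in_space by simp
  next
    case False
    then obtain m where "j = m + 1" "1 \<le> m" using branch(3) by (intro that[of "j - 1"]) auto
    then show ?thesis using branch phi_Suc branch_vertex_in_space by simp
  qed
qed

text \<open>One step back along the circuit lowers the index \<open>s\<close> of \<open>x0 s\<close> by one modulo \<open>\<kappa>\<close>, and one
  step down a branch lowers \<open>s + j\<close> by one; at the foot of the branch \<open>x s i 1\<close> is sent to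
  \<open>x0 s\<close>, which continues the same count with \<open>j = 0\<close>. Since the equivalence holds in both
  directions, the preimage of a class is exactly one class.\<close>

lemma phi_in_merging_class_iff:
  assumes "v \<in> space M"
  shows "\<phi> v \<in> merging_class p \<longleftrightarrow> v \<in> merging_class (p + 1)"
  using assms
proof (cases rule: vertex_cases)
  case (circuit s)
  obtain t where t: "t \<in> {1..\<kappa>}" "\<phi> (x0 s) = x0 t" "int \<kappa> dvd int s - (int t + 1)"
    using phi_circuit_pred[OF circuit(1)] .
  have "int \<kappa> dvd int t - p \<longleftrightarrow> int \<kappa> dvd int s - (p + 1)"
    using dvd_add_right_iff[OF t(3), of "int t - p"] by (simp add: algebra_simps)
  then show ?thesis using circuit t circuit_in_merging_class by simp
next
  case (branch s i j)
  show ?thesis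
  proof (cases "j = 1")
    case True
    then show ?thesis
      using branch phi_1 circuit_in_merging_class branch_in_merging_class by simp
  next
    case False
    then obtain m where "j = m + 1" "1 \<le> m"
      using branch(3) by (intro that[of "j - 1"]) auto
    then show ?thesis using branch phi_Suc branch_in_merging_class by (simp add: algebra_simps)
  qed
qed

text \<open>A branch vertex at height \<open>j\<close> needs \<open>j\<close> steps to merge with the circuit vertex of its class.
  The induction on \<open>j\<close> lets \<open>r\<close> vary: one step moves down the branch and at the same time back
  along the circuit, which keeps both vertices in a common class.\<close>

lemma phi_merges_with_circuit:
  assumes "r \<in> {1..\<kappa>}" and "v \<in> merging_class (int r)"
  obtains n where "(\<phi> ^^ n) v = (\<phi> ^^ n) (x0 r)"
proof -
  have branch: "(\<phi> ^^ j) (x s i j) = (\<phi> ^^ j) (x0 r)"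
    if "1 \<le> j" "r \<in> {1..\<kappa>}" "s \<in> {1..\<kappa>}" "i \<in> J (\<eta> s)" "int \<kappa> dvd int s + int j - int r"
    for j r s i
    using that
  proof (induction j arbitrary: r rule: dec_induct)
    case base
    then have "r = Phi2 \<kappa> (1 + int s)"
      using Phi2_eq_iff[OF kappa_pos] by (simp add: dvd_diff_commute add.commute)
    then show ?case using base phi_circuit phi_1 by simp
  next
    case (step j)
    obtain t where t: "t \<in> {1..\<kappa>}" "\<phi> (x0 r) = x0 t" "int \<kappa> dvd int r - (int t + 1)"
      using phi_circuit_pred[OF step.prems(1)] .
    have "int \<kappa> dvd int s + int j - int t"
      using dvd_add[OF step.prems(4) t(3)] by (simp add: algebra_simps)
    then have "(\<phi> ^^ j) (x s i j) = (\<phi> ^^ j) (x0 t)"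
      using step.IH t(1) step.prems by blast
    moreover have "\<phi> (x s i (Suc j)) = x s i j"
      using phi_Suc step by simp
    ultimately show ?case using t(2) by (simp only: funpow_Suc_right comp_apply)
  qed
  show thesis
  proof (rule vertex_cases[of v])
    show "v \<in> space M" using assms(2) merging_class_subset_space by blast
  next
    fix s assume s: "s \<in> {1..\<kappa>}" "v = x0 s"
    then have "int \<kappa> dvd int s - int r" using assms(2) circuit_in_merging_class by simp
    then have "s = r"
      using dvd_diff_index_iff[OF kappa_pos s(1) assms(1)] by simp
    then show thesis using that[of 0] s by simp
  next
    fix s i j assume "s \<in> {1..\<kappa>}" "i \<in> J (\<eta> s)" "1 \<le> j" "v = x s i j"
    then show thesis using that[of j] branch[of j r s i] assms branch_in_merging_class by simp
  qed
qed

section \<open>The composition operator on merging classes\<close>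

lemma comp_op_funpow:
  "(comp_op M \<phi> ^^ n) f v = f ((\<phi> ^^ n) v)" if "v \<in> space M"
  using that
proof (induction n arbitrary: v)
  case (Suc n)
  then show ?case using phi_in_space by (simp add: comp_op_def funpow_swap1)
qed simp

lemma comp_op_indicator:
  "comp_op M \<phi> (indicator (merging_class p)) = indicator (merging_class (p + 1))"
  using phi_in_merging_class_iff merging_class_subset_space
  by (fastforce simp: comp_op_def fun_eq_iff indicator_def)

lemma comp_op_funpow_indicator:
  "(comp_op M \<phi> ^^ n) (indicator (merging_class p)) = indicator (merging_class (p + int n))"
proof (induction n)
  case (Suc n)
  have "p + int n + 1 = p + int (Suc n)" by simp
  then show ?case using Suc comp_op_indicator[of "p + int n"] by (simp only: funpow.simps comp_apply)
qed simp

text \<open>The number \<open>n\<close> of steps after which a vertex merges with \<open>x0 r\<close> may be unbounded on the class;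
  this is why \<open>f\<close> has to lie in the range of every power.\<close>

lemma range_infinity_constant_on_merging_class:
  assumes f: "f \<in> (\<Inter>n. (comp_op M \<phi> ^^ n) ` L2 M)"
    and r: "r \<in> {1..\<kappa>}" and v: "v \<in> merging_class (int r)"
  shows "f v = f (x0 r)"
proof -
  obtain n where n: "(\<phi> ^^ n) v = (\<phi> ^^ n) (x0 r)"
    using phi_merges_with_circuit[OF r v] .
  from f obtain g where "f = (comp_op M \<phi> ^^ n) g" by blast
  moreover have "v \<in> space M" using v merging_class_subset_space by blast
  ultimately show ?thesis using comp_op_funpow n circuit_vertex_in_space[OF r] by simp
qed

section \<open>Square integrability and the measure of a class\<close>

lemma sets_M_iff: "A \<in> sets M \<longleftrightarrow> A \<subseteq> space M"
  by (simp add: sets_M)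

lemma borel_measurable_M: "f \<in> borel_measurable M"
  by (auto simp: measurable_def sets_M)

lemma indicator_in_L2_iff:
  assumes "A \<subseteq> space M"
  shows "(indicator A :: 'a \<Rightarrow> complex) \<in> L2 M \<longleftrightarrow> emeasure M A < \<infinity>"
proof -
  have "(\<lambda>v. (cmod (indicator A v))\<^sup>2) = (indicator A :: 'a \<Rightarrow> real)"
    by (auto simp: indicator_def fun_eq_iff)
  moreover have "integrable M (indicator A :: 'a \<Rightarrow> real) \<longleftrightarrow> emeasure M A < \<infinity>"
    using assms by (subst integrable_indicator_iff) (simp add: Int_absorb2 sets_M_iff)
  ultimately show ?thesis
    using assms by (auto simp: L2_def borel_measurable_M indicator_def)
qed

text \<open>If \<open>f\<close> were a nonzero constant \<open>c\<close> on \<open>A\<close>, the integrable function \<open>\<bar>f\<bar>\<^sup>2 / \<bar>c\<bar>\<^sup>2\<close> would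
  dominate the indicator of \<open>A\<close>.\<close>

lemma L2_constant_on_infinite_measure:
  assumes f: "f \<in> L2 M" and A: "A \<subseteq> space M" "emeasure M A = \<infinity>"
    and c: "\<And>v. v \<in> A \<Longrightarrow> f v = c"
  shows "c = 0"
proof (rule ccontr)
  assume "c \<noteq> 0"
  have "(indicator A :: 'a \<Rightarrow> complex) \<in> L2 M"
  proof -
    have "integrable M (\<lambda>v. (cmod (f v))\<^sup>2 / (cmod c)\<^sup>2)"
      using f by (simp add: L2_def)
    then have "integrable M (\<lambda>v. (cmod (indicator A v))\<^sup>2)"
      by (rule Bochner_Integration.integrable_bound)
        (use c \<open>c \<noteq> 0\<close> in \<open>auto simp: borel_measurable_M indicator_def\<close>)
    then show ?thesis using A(1) by (auto simp: L2_def borel_measurable_M indicator_def)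
  qed
  then show False using A indicator_in_L2_iff by simp
qed

text \<open>The threefold sum is countable additivity applied three times: over the branches at a vertex,
  over the circuit vertices that contribute at height \<open>j\<close>, and over the heights.\<close>

lemma emeasure_merging_class:
  assumes r: "r \<in> {1..\<kappa>}"
  shows "emeasure M (merging_class (int r)) = emeasure M {x0 r} +
    (\<Sum>\<^sub>\<infinity>j\<in>{1..}. \<Sum>s\<in>{s\<in>{1..\<kappa>}. r = Phi2 \<kappa> (int s + int j)}.
       \<Sum>\<^sub>\<infinity>i\<in>J (\<eta> s). emeasure M {x s i j})"
proof -
  define S where "S j = {s\<in>{1..\<kappa>}. r = Phi2 \<kappa> (int s + int j)}" for j
  define B where "B j s = (\<Union>i\<in>J (\<eta> s). {x s i j})" for j s
  define C where "C j = (\<Union>s\<in>S j. B j s)" for j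
  have B_space: "B j s \<subseteq> space M" if "1 \<le> j" "s \<in> S j" for j s
    using that branch_vertex_in_space by (auto simp: B_def S_def)
  have C_space: "C j \<subseteq> space M" if "1 \<le> j" for j
    using that B_space by (auto simp: C_def)
  have row: "(\<Sum>\<^sub>\<infinity>i\<in>J (\<eta> s). emeasure M {x s i j}) = emeasure M (B j s)"
    if "1 \<le> j" "s \<in> S j" for j s
    unfolding B_def
    using that branch_vertex_in_space branch_vertex_eq_iff
    by (intro infsum_emeasure_UN) (auto simp: S_def disjoint_family_on_def sets_M_iff)
  have level: "(\<Sum>s\<in>S j. emeasure M (B j s)) = emeasure M (C j)" if "1 \<le> j" for j
    unfolding C_def
  proof (rule sum_emeasure)
    show "B j ` S j \<subseteq> sets M" using that B_space by (auto simp: sets_M)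
    show "disjoint_family_on (B j) (S j)"
      using that branch_vertex_eq_iff by (auto simp: disjoint_family_on_def B_def S_def)
    show "finite (S j)" by (simp add: S_def)
  qed
  have "(\<Sum>\<^sub>\<infinity>j\<in>{1..}. \<Sum>s\<in>S j. \<Sum>\<^sub>\<infinity>i\<in>J (\<eta> s). emeasure M {x s i j})
      = (\<Sum>\<^sub>\<infinity>j\<in>{1..}. emeasure M (C j))"
    using row level by (intro infsum_cong) simp
  also have "\<dots> = emeasure M (\<Union>j\<in>{1..}. C j)"
    using C_space branch_vertex_eq_iff
    by (intro infsum_emeasure_UN) (auto simp: sets_M_iff disjoint_family_on_def C_def B_def S_def)
  finally have series: "(\<Sum>\<^sub>\<infinity>j\<in>{1..}. \<Sum>s\<in>S j. \<Sum>\<^sub>\<infinity>i\<in>J (\<eta> s). emeasure M {x s i j})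
      = emeasure M (\<Union>j\<in>{1..}. C j)" .
  have "{x0 s |s. s \<in> {1..\<kappa>} \<and> int \<kappa> dvd int s - int r} = {x0 r}"
    using dvd_diff_index_iff[OF kappa_pos _ r] r by blast
  moreover have "r = Phi2 \<kappa> (int s + int j) \<longleftrightarrow> int \<kappa> dvd int s + int j - int r" for s j
    using Phi2_eq_iff[OF kappa_pos r] by (simp add: dvd_diff_commute)
  then have "{x s i j |s i j. s \<in> {1..\<kappa>} \<and> i \<in> J (\<eta> s) \<and> 1 \<le> j \<and>
      int \<kappa> dvd int s + int j - int r} = (\<Union>j\<in>{1..}. C j)"
    by (auto simp only: C_def B_def S_def)
  ultimately have "merging_class (int r) = {x0 r} \<union> (\<Union>j\<in>{1..}. C j)"
    unfolding merging_class_def by simp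
  moreover have "x0 r \<notin> (\<Union>j\<in>{1..}. C j)"
    using disjoint[OF r] by (auto simp: C_def B_def S_def)
  ultimately have "emeasure M (merging_class (int r)) = emeasure M {x0 r} + emeasure M (\<Union>j\<in>{1..}. C j)"
    using C_space circuit_vertex_in_space[OF r]
    by (simp only:) (rule plus_emeasure[symmetric], auto simp: sets_M_iff)
  then show ?thesis using series by (simp add: S_def)
qed

lemma series_infinite_iff:
  assumes r: "r \<in> {1..\<kappa>}"
  shows "(\<Sum>\<^sub>\<infinity>j\<in>{1..}. \<Sum>s\<in>{s\<in>{1..\<kappa>}. r = Phi2 \<kappa> (int s + int j)}.
      \<Sum>\<^sub>\<infinity>i\<in>J (\<eta> s). emeasure M {x s i j}) = \<infinity> \<longleftrightarrow> emeasure M (merging_class (int r)) = \<infinity>"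
  using mass[OF circuit_vertex_in_space[OF r]]
  by (auto simp: emeasure_merging_class[OF r])

section \<open>Analyticity\<close>

lemma L2_zero: "(\<lambda>v. 0) \<in> L2 M"
  by (simp add: L2_def)

text \<open>Applying the operator \<open>\<kappa>\<close> times turns the indicator of a class once around the cycle of
  classes, back to itself; boundedness keeps the indicators on the way in the space.\<close>

lemma indicator_in_range_infinity:
  assumes bounded: "bounded_operator_L2 M (comp_op M \<phi>)"
    and fin: "emeasure M (merging_class p) < \<infinity>"
  shows "(indicator (merging_class p) :: 'a \<Rightarrow> complex) \<in> (\<Inter>n. (comp_op M \<phi> ^^ n) ` L2 M)"
proof
  fix n
  have "(comp_op M \<phi> ^^ m) (indicator (merging_class p)) \<in> L2 M" for m
  proof (induction m)
    case 0
    show ?case using fin indicator_in_L2_iff merging_class_subset_space by simp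
  next
    case (Suc m)
    then show ?case using bounded by (simp add: bounded_operator_L2_def)
  qed
  \<comment> \<open>A preimage under the \<open>n\<close>-th power: \<open>n * (\<kappa> - 1)\<close> steps forward, so that \<open>n\<close> further steps
     complete \<open>n\<close> turns around the circuit.\<close>
  then have "indicator (merging_class (p + int (n * (\<kappa> - 1)))) \<in> L2 M"
    by (simp only: comp_op_funpow_indicator)
  moreover have "(comp_op M \<phi> ^^ n) (indicator (merging_class (p + int (n * (\<kappa> - 1)))))
      = indicator (merging_class p)"
  proof -
    have "p + int (n * (\<kappa> - 1)) + int n - p = int \<kappa> * int n"
      using kappa_pos by (simp add: of_nat_diff algebra_simps)
    then have "merging_class (p + int (n * (\<kappa> - 1)) + int n) = merging_class p"
      by (intro merging_class_shift) simp
    then show ?thesis by (simp only: comp_op_funpow_indicator)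
  qed
  ultimately show "indicator (merging_class p) \<in> (comp_op M \<phi> ^^ n) ` L2 M"
    by (metis imageI)
qed

lemma zero_in_range_infinity: "(\<lambda>v. 0) \<in> (\<Inter>n. (comp_op M \<phi> ^^ n) ` L2 M)"
proof
  fix n
  have "(comp_op M \<phi> ^^ n) (\<lambda>v. 0) = (\<lambda>v. 0)"
    by (induction n) (simp_all add: comp_op_def fun_eq_iff)
  then show "(\<lambda>v. 0) \<in> (comp_op M \<phi> ^^ n) ` L2 M" using L2_zero by (metis imageI)
qed

lemma analytic_iff_merging_classes_infinite:
  assumes bounded: "bounded_operator_L2 M (comp_op M \<phi>)"
  shows "analytic_L2 M (comp_op M \<phi>) \<longleftrightarrow>
    (\<forall>r\<in>{1..\<kappa>}. emeasure M (merging_class (int r)) = \<infinity>)"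
proof
  assume analytic: "analytic_L2 M (comp_op M \<phi>)"
  show "\<forall>r\<in>{1..\<kappa>}. emeasure M (merging_class (int r)) = \<infinity>"
  proof (intro ballI, rule ccontr)
    fix r assume r: "r \<in> {1..\<kappa>}" and "emeasure M (merging_class (int r)) \<noteq> \<infinity>"
    then have "(indicator (merging_class (int r)) :: 'a \<Rightarrow> complex) = (\<lambda>v. 0)"
      using indicator_in_range_infinity[OF bounded, of "int r"] analytic
      unfolding analytic_L2_def by (metis less_top infinity_ennreal_def singletonD)
    moreover have "x0 r \<in> merging_class (int r)"
      using circuit_in_merging_class[OF r] by simp
    ultimately show False
      by (metis indicator_simps(1) zero_neq_one)
  qed
next
  assume inf: "\<forall>r\<in>{1..\<kappa>}. emeasure M (merging_class (int r)) = \<infinity>"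
  have "f = (\<lambda>v. 0)" if f: "f \<in> (\<Inter>n. (comp_op M \<phi> ^^ n) ` L2 M)" for f
  proof
    fix v
    have L2: "f \<in> L2 M" using INT_D[OF f, of 0] by simp
    show "f v = 0"
    proof (cases "v \<in> space M")
      case True
      then obtain r where r: "r \<in> {1..\<kappa>}" "v \<in> merging_class (int r)"
        by (rule vertex_in_some_merging_class)
      have "f w = f (x0 r)" if "w \<in> merging_class (int r)" for w
        using range_infinity_constant_on_merging_class[OF f r(1) that] .
      moreover from this have "f (x0 r) = 0"
        using L2_constant_on_infinite_measure[OF L2 merging_class_subset_space] inf r(1) by blast
      ultimately show ?thesis using r(2) by simp
    qed (use L2 in \<open>simp add: L2_def\<close>)
  qed
  then show "analytic_L2 M (comp_op M \<phi>)"
    unfolding analytic_L2_def using zero_in_range_infinity by blast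
qed

end

theorem theorem2p2:
  fixes \<kappa> :: nat and \<eta> :: "nat \<Rightarrow> enat"
    and x0 :: "nat \<Rightarrow> 'a" and x :: "nat \<Rightarrow> nat \<Rightarrow> nat \<Rightarrow> 'a"
    and M :: "'a measure" and \<phi> :: "'a \<Rightarrow> 'a"
  assumes "one_circuit_graph \<kappa> \<eta> x0 x M \<phi>"
    and "bounded_operator_L2 M (comp_op M \<phi>)"
  shows "analytic_L2 M (comp_op M \<phi>) \<longleftrightarrow>
    (\<forall>r\<in>{1..\<kappa>}.
      (\<Sum>\<^sub>\<infinity>j\<in>{1..}. \<Sum>s\<in>{s\<in>{1..\<kappa>}. r = Phi2 \<kappa> (int s + int j)}.
         \<Sum>\<^sub>\<infinity>i\<in>J (\<eta> s). emeasure M {x s i j}) = \<infinity>)"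
proof -
  interpret one_circuit_graph \<kappa> \<eta> x0 x M \<phi> by (rule assms(1))
  show ?thesis
    using analytic_iff_merging_classes_infinite[OF assms(2)] series_infinite_iff by simp
qed

end
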